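(* Let $n\ge 3$, $R>0$, let $0=x_1=r_1<x_2=r_2<\dots<x_n=r_n=R$ be a (possibly nonuniform) mesh, and let real numbers $q_1=q(x_1)$ and $q_i'=q'(x_i)$, $i=1,\dots,n-1$, be given. Let $k_1,\dots,k_{n-1}$ be the numerical solution, by the second generalized quadrature method, of the Abel equation $$2\int_x^R\frac{r}{\sqrt{r^2-x^2}}\,k(r)\,dr=q(x),\qquad 0\le x\le R,$$ based on the inversion formula $$k(r)=-\frac1\pi\int_r^R\frac{q'(x)}{\sqrt{x^2-r^2}}\,dx,\qquad 0\le r\le R .$$ Then $$k_j=-\frac1\pi\sum_{i=j}^{n-1}g_{ij}\,q_i',\qquad j=2,3,\dots,n-1,$$ $$k_1=\frac{q_1/2-\sum_{j=2}^{n-1}(r_{j+1}-r_j)\,k_j}{r_2},$$ where $$g_{ij}=\ln\frac{x_{i+1}+\sqrt{x_{i+1}^2-r_j^2}}{x_i+\sqrt{x_i^2-r_j^2}},\qquad 2\le j\le i\le n-1 .$$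
   Context: Second generalized quadrature method: the derivative $q'$ is approximated by the step function $\widetilde{q'}$ with $\widetilde{q'}(x)=q_i'$ for $x\in[x_i,x_{i+1})$, $i=1,\dots,n-1$, and for $j=2,\dots,n-1$ one sets $$k_j=-\frac1\pi\int_{r_j}^R\frac{\widetilde{q'}(x)}{\sqrt{x^2-r_j^2}}\,dx .$$ For $j=1$ (where this expression is indeterminate) the value $k_1$ is determined instead by the first generalized quadrature method: with the already computed $k_2,\dots,k_{n-1}$ and the step function $\widetilde k(r)=k_j$ for $r\in[r_j,r_{j+1})$, $j=1,\dots,n-1$, the number $k_1$ is required to satisfy the Abel equation with $k$ replaced by $\widetilde k$ at $x=x_1=0$, i.e. $$2\int_{x_1}^R\frac{r}{\sqrt{r^2-x_1^2}}\,\widetilde k(r)\,dr=q_1 .$$ Integrals with an endpoint singularity are convergent improper integrals. *)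

theory Defs
  imports "HOL-Analysis.Analysis"
begin

text \<open>
  Integrals are Henstock--Kurzweil integrals, which subsume convergent improper integrals with an
  endpoint singularity; the value of an integrand at the singular endpoint (a division by zero)
  is irrelevant.
\<close>

definition abel :: "real \<Rightarrow> (real \<Rightarrow> real) \<Rightarrow> real \<Rightarrow> real" where
  "abel R k x = 2 * integral {x..R} (\<lambda>r. r / sqrt (r\<^sup>2 - x\<^sup>2) * k r)"

definition abel_inversion :: "real \<Rightarrow> (real \<Rightarrow> real) \<Rightarrow> real \<Rightarrow> real" where
  "abel_inversion R q' r = - (1 / pi) * integral {r..R} (\<lambda>x. q' x / sqrt (x\<^sup>2 - r\<^sup>2))"

definition is_mesh :: "nat \<Rightarrow> real \<Rightarrow> (nat \<Rightarrow> real) \<Rightarrow> bool" where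
  "is_mesh n R x \<longleftrightarrow> x 1 = 0 \<and> x n = R \<and> (\<forall>i\<in>{1..n-1}. x i < x (i + 1))"

text \<open>The step function is 0 outside \<open>[x 1, x n)\<close>; its value at the single point \<open>x n\<close> is immaterial.\<close>

definition step_fun :: "nat \<Rightarrow> (nat \<Rightarrow> real) \<Rightarrow> (nat \<Rightarrow> real) \<Rightarrow> real \<Rightarrow> real" where
  "step_fun n x c t = (\<Sum>i=1..n-1. c i * indicator {x i..<x (i + 1)} t)"

lemma is_mesh_mono:
  assumes "is_mesh n R x" "1 \<le> i" "i \<le> j" "j \<le> n"
  shows "x i \<le> x j"
  using assms(3,4)
proof (induction j rule: dec_induct)
  case (step m)
  then have "m \<in> {1..n-1}" using assms(2) by auto
  then have "x m < x (m + 1)" using assms(1) unfolding is_mesh_def by blast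
  with step show ?case by auto
qed simp

lemma step_fun_eq:
  assumes m: "is_mesh n R x" and i: "i \<in> {1..n-1}" and t: "t \<in> {x i..<x (i + 1)}"
  shows "step_fun n x c t = c i"
proof -
  have "c l * indicator {x l..<x (l + 1)} t = (if l = i then c i else 0)"
    if l: "l \<in> {1..n-1}" for l
  proof (cases l i rule: linorder_cases)
    case less
    then have "x (l + 1) \<le> x i" using i l by (intro is_mesh_mono[OF m]) auto
    then show ?thesis using less t by auto
  next
    case greater
    then have "x (i + 1) \<le> x l" using i l by (intro is_mesh_mono[OF m]) auto
    then show ?thesis using greater t by auto
  qed (use t in auto)
  then have "step_fun n x c t = (\<Sum>l=1..n-1. if l = i then c i else 0)"
    unfolding step_fun_def by (intro sum.cong) auto
  then show ?thesis using i by simp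
qed

text \<open>
  The inversion formula determines \<open>k j\<close> for \<open>j \<ge> 2\<close>; \<open>k 1\<close> is determined implicitly by
  collocating the Abel equation at \<open>x 1\<close>, the step function there involving all of
  \<open>k 1, \<dots>, k (n - 1)\<close>.
\<close>

definition second_quadrature_solution ::
  "nat \<Rightarrow> real \<Rightarrow> (nat \<Rightarrow> real) \<Rightarrow> (nat \<Rightarrow> real) \<Rightarrow> real \<Rightarrow> (nat \<Rightarrow> real) \<Rightarrow> (nat \<Rightarrow> real) \<Rightarrow> bool"
where
  "second_quadrature_solution n R x r q1 q' k \<longleftrightarrow>
     (\<forall>j\<in>{2..n-1}. k j = abel_inversion R (step_fun n x q') (r j)) \<and>
     abel R (step_fun n r k) (x 1) = q1"

definition quadrature_weight :: "(nat \<Rightarrow> real) \<Rightarrow> (nat \<Rightarrow> real) \<Rightarrow> nat \<Rightarrow> nat \<Rightarrow> real" where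
  "quadrature_weight x r i j =
     ln ((x (i + 1) + sqrt ((x (i + 1))\<^sup>2 - (r j)\<^sup>2)) / (x i + sqrt ((x i)\<^sup>2 - (r j)\<^sup>2)))"

end

theory Submission
  imports Defs
begin

text \<open>
  Both quadrature rules integrate a step function against a kernel that has an elementary
  antiderivative, continuous up to the lower end of the range even where the kernel is singular.
  By the fundamental theorem of calculus the kernel has an exact integral over each mesh interval,
  and the integral of kernel times step function is the sum of these cell integrals weighted by
  the step values (\<open>has_integral_step_fun_mult\<close>).

  For the inversion formula at \<open>r j > 0\<close> the kernel \<open>1 / sqrt (t\<^sup>2 - (r j)\<^sup>2)\<close> has the antiderivative
  \<open>ln (t + sqrt (t\<^sup>2 - (r j)\<^sup>2))\<close>, whose increments over the mesh intervals are the quadrature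
  weights (\<open>has_integral_inversion_kernel\<close>). For the Abel equation at \<open>0\<close> the kernel
  \<open>t / sqrt (t\<^sup>2)\<close> is \<open>1\<close> on the positive axis, so collocation at \<open>x 1 = 0\<close> is the linear equation
  \<open>2 * (\<Sum>j=1..n-1. (r (j + 1) - r j) * k j) = q1\<close>. It determines \<open>k 1\<close>, because the increment
  multiplying \<open>k 1\<close> is \<open>r 2 - r 1 = r 2 > 0\<close>.
\<close>

lemma has_integral_step_fun_mult:
  assumes mesh: "is_mesh n R x" and j: "1 \<le> j" "j \<le> n"
    and w: "\<And>i. i \<in> {j..<n} \<Longrightarrow> (w has_integral g i) {x i..x (i + 1)}"
  shows "((\<lambda>t. step_fun n x c t * w t) has_integral (\<Sum>i=j..n-1. c i * g i)) {x j..R}"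
proof -
  have "((\<lambda>t. step_fun n x c t * w t) has_integral (\<Sum>i=j..<m. c i * g i)) {x j..x m}"
    if "j \<le> m" "m \<le> n" for m
    using that
  proof (induction m rule: dec_induct)
    case base
    show ?case by (simp add: has_integral_refl)
  next
    case (step m)
    \<comment> \<open>At the right end of the cell the step function already takes its next value.\<close>
    have cell: "((\<lambda>t. step_fun n x c t * w t) has_integral c m * g m) {x m..x (m + 1)}"
    proof (rule has_integral_spike_finite)
      show "((\<lambda>t. c m * w t) has_integral c m * g m) {x m..x (m + 1)}"
        using w[of m] step by (intro has_integral_mult_right) auto
      show "step_fun n x c t * w t = c m * w t"
        if "t \<in> {x m..x (m + 1)} - {x (m + 1)}" for t
        using step_fun_eq[OF mesh, of m t c] that step j by auto
    qed simp
    have "x j \<le> x m" "x m \<le> x (m + 1)"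
      using step j by (auto intro!: is_mesh_mono[OF mesh])
    from has_integral_combine[OF this step.IH cell] step show ?case
      by simp
  qed
  from this[of n] show ?thesis
    using mesh j by (auto simp: is_mesh_def atLeastLessThanSuc_atLeastAtMost[symmetric])
qed

text \<open>
  The case \<open>u = a\<close> is the singular cell: the antiderivative \<open>ln (t + sqrt (t\<^sup>2 - a\<^sup>2))\<close> is
  differentiable only in the interior, but continuous at \<open>a\<close> as well, since \<open>a > 0\<close>.
\<close>

lemma has_integral_inversion_kernel:
  fixes a u v :: real
  assumes "0 < a" "a \<le> u" "u \<le> v"
  shows "((\<lambda>t. 1 / sqrt (t\<^sup>2 - a\<^sup>2)) has_integral
      ln ((v + sqrt (v\<^sup>2 - a\<^sup>2)) / (u + sqrt (u\<^sup>2 - a\<^sup>2)))) {u..v}"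
proof -
  have nonneg: "0 \<le> t\<^sup>2 - a\<^sup>2" if "u \<le> t" for t
    using assms that by simp
  have pos: "0 < t + sqrt (t\<^sup>2 - a\<^sup>2)" if "u \<le> t" for t
    using assms that nonneg[OF that] by (intro add_pos_nonneg) auto
  have "((\<lambda>t. 1 / sqrt (t\<^sup>2 - a\<^sup>2)) has_integral
      ln (v + sqrt (v\<^sup>2 - a\<^sup>2)) - ln (u + sqrt (u\<^sup>2 - a\<^sup>2))) {u..v}"
  proof (rule fundamental_theorem_of_calculus_interior[OF \<open>u \<le> v\<close>])
    show "continuous_on {u..v} (\<lambda>t. ln (t + sqrt (t\<^sup>2 - a\<^sup>2)))"
      by (intro continuous_intros) (use pos in force)
    fix t assume t: "t \<in> {u<..<v}"
    define s where "s = sqrt (t\<^sup>2 - a\<^sup>2)"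
    have "0 < t\<^sup>2 - a\<^sup>2"
      using assms t by (simp add: power_strict_mono)
    then have "0 < s" and "0 < t + s"
      using pos[of t] t by (auto simp: s_def)
    have "((\<lambda>t. sqrt (t\<^sup>2 - a\<^sup>2)) has_real_derivative t / s) (at t)"
      unfolding s_def using \<open>0 < t\<^sup>2 - a\<^sup>2\<close>
      by (auto intro!: derivative_eq_intros simp: field_simps)
    from DERIV_ln_divide[THEN DERIV_chain2, OF _ DERIV_add[OF DERIV_ident this]] \<open>0 < t + s\<close>
    have "((\<lambda>t. ln (t + sqrt (t\<^sup>2 - a\<^sup>2))) has_real_derivative
        (1 + t / s) / (t + s)) (at t)"
      by (simp add: s_def)
    moreover have "(1 + t / s) / (t + s) = 1 / s"
      using \<open>0 < s\<close> \<open>0 < t + s\<close> by (simp add: divide_simps)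
    ultimately show "((\<lambda>t. ln (t + sqrt (t\<^sup>2 - a\<^sup>2))) has_vector_derivative
        1 / sqrt (t\<^sup>2 - a\<^sup>2)) (at t)"
      by (simp add: has_real_derivative_iff_has_vector_derivative s_def)
  qed
  then show ?thesis
    using pos[of u] pos[of v] assms by (simp add: ln_div)
qed

lemma has_integral_abel_kernel_at_0:
  fixes u v :: real
  assumes "0 \<le> u" "u \<le> v"
  shows "((\<lambda>t. t / sqrt (t\<^sup>2 - 0\<^sup>2)) has_integral v - u) {u..v}"
proof (rule has_integral_spike_finite[where S = "{0}"])
  show "((\<lambda>t. 1) has_integral v - u) {u..v}"
    using has_integral_const_real[of "1::real" u v] assms by simp
qed (use assms in auto)

lemma abel_inversion_step_fun:
  assumes mesh: "is_mesh n R x" and j: "j \<in> {2..n-1}"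
  shows "abel_inversion R (step_fun n x c) (x j) =
    - (1 / pi) * (\<Sum>i=j..n-1. quadrature_weight x x i j * c i)"
proof -
  have "x 1 < x 2"
    using mesh j unfolding is_mesh_def by (auto dest!: bspec[of _ _ 1] simp: numeral_2_eq_2)
  also have "x 2 \<le> x j"
    using j by (intro is_mesh_mono[OF mesh]) auto
  finally have "0 < x j"
    using mesh by (simp add: is_mesh_def)
  have "((\<lambda>t. step_fun n x c t * (1 / sqrt (t\<^sup>2 - (x j)\<^sup>2))) has_integral
      (\<Sum>i=j..n-1. c i * quadrature_weight x x i j)) {x j..R}"
  proof (rule has_integral_step_fun_mult[OF mesh])
    fix i assume "i \<in> {j..<n}"
    then have "x j \<le> x i" "x i \<le> x (i + 1)"
      using j by (auto intro!: is_mesh_mono[OF mesh])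
    from has_integral_inversion_kernel[OF \<open>0 < x j\<close> this]
    show "((\<lambda>t. 1 / sqrt (t\<^sup>2 - (x j)\<^sup>2)) has_integral quadrature_weight x x i j)
        {x i..x (i + 1)}"
      by (simp add: quadrature_weight_def)
  qed (use j in auto)
  then show ?thesis
    by (simp add: abel_inversion_def integral_unique mult.commute)
qed

lemma abel_step_fun_at_0:
  assumes mesh: "is_mesh n R x" and "n \<ge> 1"
  shows "abel R (step_fun n x c) 0 = 2 * (\<Sum>i=1..n-1. (x (i + 1) - x i) * c i)"
proof -
  have "((\<lambda>t. step_fun n x c t * (t / sqrt (t\<^sup>2 - 0\<^sup>2))) has_integral
      (\<Sum>i=1..n-1. c i * (x (i + 1) - x i))) {x 1..R}"
  proof (rule has_integral_step_fun_mult[OF mesh])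
    fix i assume "i \<in> {1..<n}"
    then have "x 1 \<le> x i" "x i \<le> x (i + 1)"
      by (auto intro!: is_mesh_mono[OF mesh])
    then show "((\<lambda>t. t / sqrt (t\<^sup>2 - 0\<^sup>2)) has_integral x (i + 1) - x i) {x i..x (i + 1)}"
      using mesh by (intro has_integral_abel_kernel_at_0) (auto simp: is_mesh_def)
  qed (use assms in auto)
  moreover have "x 1 = 0"
    using mesh by (simp add: is_mesh_def)
  ultimately show ?thesis
    unfolding abel_def by (simp only: mult.commute integral_unique)
qed

theorem theorem2p2:
  fixes n :: nat and R q1 :: real and x r q' k :: "nat \<Rightarrow> real"
  assumes "n \<ge> 3" and "R > 0"
    and "is_mesh n R x"
    and "\<forall>i\<in>{1..n}. r i = x i"
    and "second_quadrature_solution n R x r q1 q' k"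
  shows "(\<forall>j\<in>{2..n-1}. k j = - (1 / pi) * (\<Sum>i=j..n-1. quadrature_weight x r i j * q' i))
    \<and> k 1 = (q1 / 2 - (\<Sum>j=2..n-1. (r (j + 1) - r j) * k j)) / r 2"
proof (intro conjI ballI)
  fix j assume j: "j \<in> {2..n-1}"
  then have "r j = x j"
    using assms(4) by auto
  then show "k j = - (1 / pi) * (\<Sum>i=j..n-1. quadrature_weight x r i j * q' i)"
    using assms(5) abel_inversion_step_fun[OF assms(3) j, of q'] j
    by (simp add: second_quadrature_solution_def quadrature_weight_def)
next
  have mesh: "is_mesh n R r"
    using assms(1,3,4) by (auto simp: is_mesh_def)
  then have "r 1 = 0"
    by (simp add: is_mesh_def)
  moreover have "r 1 < r 2"
    using mesh assms(1) unfolding is_mesh_def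
    by (auto dest!: bspec[of _ _ 1] simp: numeral_2_eq_2)
  moreover have "2 * (\<Sum>i=1..n-1. (r (i + 1) - r i) * k i) = q1"
    using abel_step_fun_at_0[OF mesh, of k] assms(1,3,5)
    by (simp add: second_quadrature_solution_def is_mesh_def)
  moreover have "(\<Sum>i=1..n-1. (r (i + 1) - r i) * k i) =
      (r 2 - r 1) * k 1 + (\<Sum>i=2..n-1. (r (i + 1) - r i) * k i)"
    using assms(1) by (simp add: sum.atLeast_Suc_atMost numeral_2_eq_2)
  ultimately show "k 1 = (q1 / 2 - (\<Sum>j=2..n-1. (r (j + 1) - r j) * k j)) / r 2"
    by (simp add: field_simps)
qed

end
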